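(* Let $1<\alpha\le2$, let $K_1,K_2\ge0$ be constants with $K_1^2+K_2^2\neq0$, and let $(p,q)\in\{(1,0),(1,-1)\}$. The CN-WSGD finite difference scheme $$U_i^{n+1}-\frac{K_1\tau}{2h^{\alpha}}\sum_{k=0}^{i+1}w_k^{(\alpha)}U_{i-k+1}^{n+1}-\frac{K_2\tau}{2h^{\alpha}}\sum_{k=0}^{N-i+1}w_k^{(\alpha)}U_{i+k-1}^{n+1}$$ $$=U_i^n+\frac{K_1\tau}{2h^{\alpha}}\sum_{k=0}^{i+1}w_k^{(\alpha)}U_{i-k+1}^n+\frac{K_2\tau}{2h^{\alpha}}\sum_{k=0}^{N-i+1}w_k^{(\alpha)}U_{i+k-1}^n+\tau f_i^{n+1/2},\qquad 1\le i\le N-1,\ 0\le n\le M-1,$$ with initial values $U_i^0=u_0(x_i)$ and boundary values $U_0^n=\phi_a(t_n)$, $U_N^n=\phi_b(t_n)$, is unconditionally stable.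
   Context: The scheme discretizes the two-sided one-dimensional space fractional diffusion equation $\frac{\partial u}{\partial t}=K_1\,{}_aD_x^{\alpha}u+K_2\,{}_xD_b^{\alpha}u+f(x,t)$ on $(a,b)\times(0,T]$, with $u(x,0)=u_0(x)$, $u(a,t)=\phi_a(t)$, $u(b,t)=\phi_b(t)$, where $\phi_a\equiv0$ if $K_1\ne0$ and $\phi_b\equiv0$ if $K_2\neq0$, and ${}_aD_x^\alpha$, ${}_xD_b^\alpha$ are the left and right Riemann-Liouville derivatives. Here $N,M$ are positive integers, $h=(b-a)/N$, $\tau=T/M$, $x_i=a+ih$, $t_n=n\tau$, $t_{n+1/2}=(t_n+t_{n+1})/2$, $f_i^{n+1/2}=f(x_i,t_{n+1/2})$. With $g_0^{(\alpha)}=1$, $g_k^{(\alpha)}=\left(1-\frac{\alpha+1}{k}\right)g_{k-1}^{(\alpha)}$ ($k\ge1$), the coefficients are: for $(p,q)=(1,0)$: $w_0^{(\alpha)}=\frac{\alpha}{2}g_0^{(\alpha)}$, $w_k^{(\alpha)}=\frac{\alpha}{2}g_k^{(\alpha)}+\frac{2-\alpha}{2}g_{k-1}^{(\alpha)}$ for $k\ge1$; for $(p,q)=(1,-1)$: $w_0^{(\alpha)}=\frac{2+\alpha}{4}g_0^{(\alpha)}$, $w_1^{(\alpha)}=\frac{2+\alpha}{4}g_1^{(\alpha)}$, $w_k^{(\alpha)}=\frac{2+\alpha}{4}g_k^{(\alpha)}+\frac{2-\alpha}{4}g_{k-2}^{(\alpha)}$ for $k\ge2$. Let $A$ be the $(N-1)\times(N-1)$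 matrix with $A_{ij}=w_{i-j+1}^{(\alpha)}$ if $i-j+1\ge0$ and $A_{ij}=0$ otherwise, and $B=\frac{\tau}{2h^{\alpha}}(K_1A+K_2A^{\mathrm{T}})$. With $U^n=(U_1^n,\dots,U_{N-1}^n)^{\mathrm{T}}$ the scheme has the form $(I-B)U^{n+1}=(I+B)U^n+(\text{terms determined by } f \text{ and the boundary data})$. "Unconditionally stable" means that, for all step sizes $\tau>0$ and $h>0$ (with no relation between $\tau$ and $h$ required), $I-B$ is invertible and the iteration matrix $(I-B)^{-1}(I+B)$ has spectral radius less than one. *)

theory Defs
  imports Complex_Main "Jordan_Normal_Form.Spectral_Radius"
    "Jordan_Normal_Form.Gauss_Jordan_Elimination"
begin

fun grunwald_coeff :: "real \<Rightarrow> nat \<Rightarrow> real" where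
  "grunwald_coeff \<alpha> 0 = 1"
| "grunwald_coeff \<alpha> (Suc k) = (1 - (\<alpha> + 1) / real (Suc k)) * grunwald_coeff \<alpha> k"

text \<open>The weights \<open>w\<^sub>k\<close> are specified only for the shifts \<open>(1, 0)\<close> and \<open>(1, -1)\<close>.\<close>

definition wsgd_weight :: "int \<Rightarrow> int \<Rightarrow> real \<Rightarrow> nat \<Rightarrow> real" where
  "wsgd_weight p q \<alpha> k =
    (if (p, q) = (1, 0) then
       (if k = 0 then \<alpha> / 2 * grunwald_coeff \<alpha> 0
        else \<alpha> / 2 * grunwald_coeff \<alpha> k + (2 - \<alpha>) / 2 * grunwald_coeff \<alpha> (k - 1))
     else if (p, q) = (1, -1) then
       (if k \<le> 1 then (2 + \<alpha>) / 4 * grunwald_coeff \<alpha> k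
        else (2 + \<alpha>) / 4 * grunwald_coeff \<alpha> k + (2 - \<alpha>) / 4 * grunwald_coeff \<alpha> (k - 2))
     else undefined)"

text \<open>
  The scheme for a grid function \<open>U\<close>, where \<open>U n i\<close> is the value at time level \<open>n\<close> and
  spatial node \<open>i\<close>. The initial condition is imposed at the interior nodes, the boundary
  condition at every time level; the values of \<open>U\<close> outside the grid are irrelevant.
\<close>

definition cn_wsgd_scheme ::
  "real \<Rightarrow> int \<Rightarrow> int \<Rightarrow> real \<Rightarrow> real \<Rightarrow> real \<Rightarrow> real \<Rightarrow> real \<Rightarrow>
   (real \<Rightarrow> real) \<Rightarrow> (real \<Rightarrow> real) \<Rightarrow> (real \<Rightarrow> real) \<Rightarrow> (real \<Rightarrow> real \<Rightarrow> real) \<Rightarrow>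
   nat \<Rightarrow> nat \<Rightarrow> (nat \<Rightarrow> nat \<Rightarrow> real) \<Rightarrow> bool" where
  "cn_wsgd_scheme \<alpha> p q K1 K2 a b T u0 \<phi>a \<phi>b f N M U \<longleftrightarrow>
    (let h = (b - a) / real N; \<tau> = T / real M; w = wsgd_weight p q \<alpha>;
         x = (\<lambda>i. a + real i * h); t = (\<lambda>n. real n * \<tau>)
     in (\<forall>n<M. \<forall>i\<in>{1..N-1}.
           U (n+1) i
             - K1 * \<tau> / (2 * h powr \<alpha>) * (\<Sum>k=0..i+1. w k * U (n+1) (i + 1 - k))
             - K2 * \<tau> / (2 * h powr \<alpha>) * (\<Sum>k=0..N-i+1. w k * U (n+1) (i + k - 1))
         = U n i
             + K1 * \<tau> / (2 * h powr \<alpha>) * (\<Sum>k=0..i+1. w k * U n (i + 1 - k))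
             + K2 * \<tau> / (2 * h powr \<alpha>) * (\<Sum>k=0..N-i+1. w k * U n (i + k - 1))
             + \<tau> * f (x i) ((t n + t (n+1)) / 2))
      \<and> (\<forall>i\<in>{1..N-1}. U 0 i = u0 (x i))
      \<and> (\<forall>n\<le>M. U n 0 = \<phi>a (t n) \<and> U n N = \<phi>b (t n)))"

text \<open>
  Indices of \<open>mat\<close> and \<open>vec\<close> start at 0, so the row with index \<open>i\<close> belongs to the spatial
  node \<open>i + 1\<close>; the difference \<open>i - j\<close> is not affected by this shift.
\<close>

definition wsgd_mat :: "real \<Rightarrow> int \<Rightarrow> int \<Rightarrow> nat \<Rightarrow> real mat" where
  "wsgd_mat \<alpha> p q N =
    mat (N - 1) (N - 1) (\<lambda>(i, j). if j \<le> i + 1 then wsgd_weight p q \<alpha> (i + 1 - j) else 0)"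

definition cn_wsgd_mat ::
  "real \<Rightarrow> int \<Rightarrow> int \<Rightarrow> real \<Rightarrow> real \<Rightarrow> nat \<Rightarrow> real \<Rightarrow> real \<Rightarrow> real mat" where
  "cn_wsgd_mat \<alpha> p q K1 K2 N \<tau> h =
    (\<tau> / (2 * h powr \<alpha>)) \<cdot>\<^sub>m
      (K1 \<cdot>\<^sub>m wsgd_mat \<alpha> p q N + K2 \<cdot>\<^sub>m transpose_mat (wsgd_mat \<alpha> p q N))"

definition interior_vec :: "nat \<Rightarrow> (nat \<Rightarrow> real) \<Rightarrow> real vec" where
  "interior_vec N v = vec (N - 1) (\<lambda>i. v (i + 1))"

text \<open>
  The inhomogeneous term of the matrix form at level \<open>n\<close>: the source term, plus the
  contributions of the boundary nodes 0 and \<open>N\<close> to the sums of the scheme, taken at both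
  time levels. Node \<open>N\<close> enters the first sum only in the equation of node \<open>N - 1\<close>, and node 0
  enters the second sum only in the equation of node 1.
\<close>

definition cn_wsgd_rhs ::
  "real \<Rightarrow> int \<Rightarrow> int \<Rightarrow> real \<Rightarrow> real \<Rightarrow> real \<Rightarrow> real \<Rightarrow> real \<Rightarrow>
   (real \<Rightarrow> real) \<Rightarrow> (real \<Rightarrow> real) \<Rightarrow> (real \<Rightarrow> real \<Rightarrow> real) \<Rightarrow> nat \<Rightarrow> nat \<Rightarrow> nat \<Rightarrow> real vec" where
  "cn_wsgd_rhs \<alpha> p q K1 K2 a b T \<phi>a \<phi>b f N M n =
    (let h = (b - a) / real N; \<tau> = T / real M; w = wsgd_weight p q \<alpha>;
         x = (\<lambda>i. a + real i * h); t = (\<lambda>n. real n * \<tau>);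
         \<beta>a = \<phi>a (t n) + \<phi>a (t (n+1)); \<beta>b = \<phi>b (t n) + \<phi>b (t (n+1))
     in interior_vec N (\<lambda>i.
          K1 * \<tau> / (2 * h powr \<alpha>) * (w (i + 1) * \<beta>a + (if i = N - 1 then w 0 * \<beta>b else 0))
          + K2 * \<tau> / (2 * h powr \<alpha>) * (w (N - i + 1) * \<beta>b + (if i = 1 then w 0 * \<beta>a else 0))
          + \<tau> * f (x i) ((t n + t (n+1)) / 2)))"

definition cn_wsgd_matrix_form ::
  "real \<Rightarrow> int \<Rightarrow> int \<Rightarrow> real \<Rightarrow> real \<Rightarrow> real \<Rightarrow> real \<Rightarrow> real \<Rightarrow>
   (real \<Rightarrow> real) \<Rightarrow> (real \<Rightarrow> real) \<Rightarrow> (real \<Rightarrow> real) \<Rightarrow> (real \<Rightarrow> real \<Rightarrow> real) \<Rightarrow>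
   nat \<Rightarrow> nat \<Rightarrow> (nat \<Rightarrow> nat \<Rightarrow> real) \<Rightarrow> bool" where
  "cn_wsgd_matrix_form \<alpha> p q K1 K2 a b T u0 \<phi>a \<phi>b f N M U \<longleftrightarrow>
    (let h = (b - a) / real N; \<tau> = T / real M; I = 1\<^sub>m (N - 1);
         B = cn_wsgd_mat \<alpha> p q K1 K2 N \<tau> h
     in (\<forall>n<M. (I - B) *\<^sub>v interior_vec N (U (n+1)) =
               (I + B) *\<^sub>v interior_vec N (U n) + cn_wsgd_rhs \<alpha> p q K1 K2 a b T \<phi>a \<phi>b f N M n)
      \<and> (\<forall>i\<in>{1..N-1}. U 0 i = u0 (a + real i * h))
      \<and> (\<forall>n\<le>M. U n 0 = \<phi>a (real n * \<tau>) \<and> U n N = \<phi>b (real n * \<tau>)))"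

definition cn_iteration_mat :: "real mat \<Rightarrow> real mat" where
  "cn_iteration_mat B =
    the (mat_inverse (1\<^sub>m (dim_row B) - B)) * (1\<^sub>m (dim_row B) + B)"

text \<open>
  Unconditional stability of a scheme \<open>(I - B) U\<^sup>n\<^sup>+\<^sup>1 = (I + B) U\<^sup>n + \<dots>\<close> with
  \<open>B = Bm N \<tau> h\<close>. For \<open>N = 1\<close> there are no interior nodes: the matrix is empty, its spectrum
  is the empty set, and \<open>Max\<close> in \<open>spectral_radius\<close> has no meaning.
\<close>

definition unconditionally_stable :: "(nat \<Rightarrow> real \<Rightarrow> real \<Rightarrow> real mat) \<Rightarrow> bool" where
  "unconditionally_stable Bm \<longleftrightarrow>
    (\<forall>N \<tau> h. 2 \<le> N \<longrightarrow> 0 < \<tau> \<longrightarrow> 0 < h \<longrightarrow>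
      invertible_mat (1\<^sub>m (N - 1) - Bm N \<tau> h) \<and>
      spectral_radius (map_mat complex_of_real (cn_iteration_mat (Bm N \<tau> h))) < 1)"

end

theory Submission
  imports Defs
begin

text \<open>
  If \<open>x \<bullet> B x < 0\<close> for all real \<open>x \<noteq> 0\<close>, then every eigenpair \<open>(\<mu>, v)\<close> of the Cayley transform
  \<open>(I - B)\<inverse> (I + B)\<close> satisfies \<open>s + \<beta> = \<mu> (s - \<beta>)\<close> with \<open>s = \<parallel>v\<parallel>\<^sup>2 > 0\<close> and
  \<open>Re \<beta> = Re (v\<^sup>* B v) < 0\<close>, so that \<open>\<bar>\<mu>\<bar> < 1\<close>. As \<open>A\<close> and its transpose have the same quadratic
  form, it remains to see that \<open>x \<bullet> A x < 0\<close>. With the autocorrelations \<open>R m\<close> of \<open>x\<close>, this form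
  equals \<open>w 0 R 1 + w 1 R 0 + w 2 R 1 + w 3 R 2 + \<dots>\<close>. Replacing each \<open>R m\<close> by \<open>R 0\<close> yields
  \<open>R 0\<close> times a partial sum of the weights, which is nonpositive. The error consists of the
  nonnegative differences \<open>R 0 - R m\<close>, whose coefficients have the good sign except possibly
  for \<open>m = 2\<close>, and \<open>R 0 - R 2\<close> is at most \<open>4 (R 0 - R 1)\<close>.
\<close>

section \<open>The matrix form of the scheme\<close>

text \<open>Substituting \<open>l = i + 1 - k\<close> lets the sum run over the nodes 0 to
  \<open>i + 1\<close>. Splitting off the boundary nodes leaves a row of the matrix product; the top
  node \<open>i + 1\<close> is the boundary node \<open>N\<close> exactly when
  \<open>i = N - 1\<close>.\<close>

lemma left_sum_conv_mat:
  assumes "1 \<le> i" "i \<le> N - 1"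
  shows "(\<Sum>k=0..i+1. wsgd_weight p q \<alpha> k * V (i + 1 - k)) =
    (wsgd_mat \<alpha> p q N *\<^sub>v interior_vec N V) $ (i - 1) + wsgd_weight p q \<alpha> (i + 1) * V 0
      + (if i = N - 1 then wsgd_weight p q \<alpha> 0 * V N else 0)"
proof -
  let ?w = "wsgd_weight p q \<alpha>"
  have "(\<Sum>k=0..i+1. ?w k * V (i + 1 - k)) = (\<Sum>l=0..i+1. ?w (i + 1 - l) * V l)"
    by (rule sum.reindex_bij_witness[of _ "\<lambda>l. i + 1 - l" "\<lambda>l. i + 1 - l"]) auto
  also have "\<dots> = ?w (i + 1) * V 0 + (\<Sum>j=0..i. ?w (i - j) * V (j + 1))"
    unfolding atLeast0AtMost Suc_eq_plus1[symmetric] sum.atMost_Suc_shift by simp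
  also have "(\<Sum>j=0..i. ?w (i - j) * V (j + 1)) =
      (\<Sum>j<N - 1. (if j \<le> i then ?w (i - j) else 0) * V (j + 1))
        + (if i = N - 1 then ?w 0 * V N else 0)"
  proof (cases "i = N - 1")
    case True
    then have "{0..i} = insert (N - 1) {..<N - 1}" by auto
    then show ?thesis using True assms by (auto intro!: sum.cong)
  next
    case False
    then have *: "{0..i} \<subseteq> {..<N - 1}" using assms by auto
    have "(\<Sum>j<N - 1. (if j \<le> i then ?w (i - j) else 0) * V (j + 1)) =
        (\<Sum>j=0..i. (if j \<le> i then ?w (i - j) else 0) * V (j + 1))"
      by (rule sum.mono_neutral_right) (use * in auto)
    then show ?thesis using False by (auto intro!: sum.cong)
  qed
  also have "(\<Sum>j<N - 1. (if j \<le> i then ?w (i - j) else 0) * V (j + 1)) =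
      (wsgd_mat \<alpha> p q N *\<^sub>v interior_vec N V) $ (i - 1)"
    using assms
    by (auto simp: wsgd_mat_def interior_vec_def scalar_prod_def atLeast0LessThan intro!: sum.cong)
  finally show ?thesis by simp
qed

lemma right_sum_conv_mat:
  assumes "1 \<le> i" "i \<le> N - 1"
  shows "(\<Sum>k=0..N-i+1. wsgd_weight p q \<alpha> k * V (i + k - 1)) =
    (transpose_mat (wsgd_mat \<alpha> p q N) *\<^sub>v interior_vec N V) $ (i - 1)
      + wsgd_weight p q \<alpha> (N - i + 1) * V N
      + (if i = 1 then wsgd_weight p q \<alpha> 0 * V 0 else 0)"
proof -
  let ?w = "wsgd_weight p q \<alpha>"
  \<comment> \<open>The summand as a function of the node \<open>l\<close>, extended by zero to the
    nodes below \<open>i - 1\<close>, so that both boundary nodes split off a sum over the whole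
    grid.\<close>
  define g where "g l = (if i \<le> l + 1 then ?w (l + 1 - i) else 0) * V l" for l
  have "(\<Sum>k=0..N-i+1. ?w k * V (i + k - 1)) = (\<Sum>l=i-1..N. g l)"
    by (rule sum.reindex_bij_witness[of _ "\<lambda>l. l + 1 - i" "\<lambda>k. i + k - 1"])
      (use assms in \<open>auto simp: g_def\<close>)
  also have "\<dots> = (\<Sum>l\<le>N. g l)"
    by (rule sum.mono_neutral_left) (auto simp: g_def)
  also have "\<dots> = g 0 + (\<Sum>j<N - 1. g (j + 1)) + g N"
  proof -
    obtain N' where N: "N = Suc (Suc N')"
      using assms by (cases N; cases "N - 1") auto
    show ?thesis
      using sum.atMost_Suc_shift[of g N'] by (simp add: N lessThan_Suc_atMost del: sum.lessThan_Suc)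
  qed
  also have "g 0 = (if i = 1 then ?w 0 * V 0 else 0)" using assms by (auto simp: g_def)
  also have "g N = ?w (N - i + 1) * V N" using assms by (auto simp: g_def Suc_diff_le)
  also have "(\<Sum>j<N - 1. g (j + 1)) =
      (transpose_mat (wsgd_mat \<alpha> p q N) *\<^sub>v interior_vec N V) $ (i - 1)"
    using assms
    by (auto simp: g_def wsgd_mat_def interior_vec_def scalar_prod_def atLeast0LessThan
        intro!: sum.cong arg_cong[of _ _ ?w])
  finally show ?thesis by simp
qed

lemma wsgd_mat_dim [simp]:
  "dim_row (wsgd_mat \<alpha> p q N) = N - 1" "dim_col (wsgd_mat \<alpha> p q N) = N - 1"
  by (simp_all add: wsgd_mat_def)

lemma cn_wsgd_mat_dim [simp]:
  "dim_row (cn_wsgd_mat \<alpha> p q K1 K2 N \<tau> h) = N - 1"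
  "dim_col (cn_wsgd_mat \<alpha> p q K1 K2 N \<tau> h) = N - 1"
  by (simp_all add: cn_wsgd_mat_def)

lemma dim_interior_vec [simp]: "dim_vec (interior_vec N v) = N - 1"
  by (simp add: interior_vec_def)

lemma wsgd_mat_carrier: "wsgd_mat \<alpha> p q N \<in> carrier_mat (N - 1) (N - 1)"
  by (rule carrier_matI) simp_all

lemma cn_wsgd_mat_carrier: "cn_wsgd_mat \<alpha> p q K1 K2 N \<tau> h \<in> carrier_mat (N - 1) (N - 1)"
  by (rule carrier_matI) simp_all

lemma interior_vec_carrier: "interior_vec N v \<in> carrier_vec (N - 1)"
  by (rule carrier_vecI) simp

lemma cn_wsgd_mat_mult_vec:
  assumes "v \<in> carrier_vec (N - 1)"
  shows "cn_wsgd_mat \<alpha> p q K1 K2 N \<tau> h *\<^sub>v v =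
    (\<tau> / (2 * h powr \<alpha>)) \<cdot>\<^sub>v (K1 \<cdot>\<^sub>v (wsgd_mat \<alpha> p q N *\<^sub>v v)
      + K2 \<cdot>\<^sub>v (transpose_mat (wsgd_mat \<alpha> p q N) *\<^sub>v v))"
proof -
  let ?A = "wsgd_mat \<alpha> p q N"
  have At: "transpose_mat ?A \<in> carrier_mat (N - 1) (N - 1)" by (rule carrier_matI) simp_all
  have smult: "(c \<cdot>\<^sub>m M) *\<^sub>v v = c \<cdot>\<^sub>v (M *\<^sub>v v)"
    if "M \<in> carrier_mat (N - 1) (N - 1)" for c :: real and M
    using that assms by (intro eq_vecI) auto
  show ?thesis
    unfolding cn_wsgd_mat_def
    using assms At wsgd_mat_carrier[of \<alpha> p q N]
    by (simp only: smult add_mult_distrib_mat_vec[of _ "N - 1" "N - 1"]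
        add_carrier_mat smult_carrier_mat)
qed

text \<open>A single equation, with \<open>U\<close> and \<open>V\<close> as old and new time level
  and \<open>s\<close> as source term. Moving the boundary terms of \<open>V\<close> to the right
  produces the sums \<open>U 0 + V 0\<close> and \<open>U N + V N\<close>.\<close>

lemma cn_wsgd_scheme_step_iff:
  fixes \<alpha> K1 K2 \<tau> h s :: real and p q :: int and U V :: "nat \<Rightarrow> real"
  assumes i: "1 \<le> i" "i \<le> N - 1"
  defines "B \<equiv> cn_wsgd_mat \<alpha> p q K1 K2 N \<tau> h" and "w \<equiv> wsgd_weight p q \<alpha>"
  shows "(V i - K1 * \<tau> / (2 * h powr \<alpha>) * (\<Sum>k=0..i+1. w k * V (i + 1 - k))
        - K2 * \<tau> / (2 * h powr \<alpha>) * (\<Sum>k=0..N-i+1. w k * V (i + k - 1))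
      = U i + K1 * \<tau> / (2 * h powr \<alpha>) * (\<Sum>k=0..i+1. w k * U (i + 1 - k))
        + K2 * \<tau> / (2 * h powr \<alpha>) * (\<Sum>k=0..N-i+1. w k * U (i + k - 1)) + s)
    \<longleftrightarrow> ((1\<^sub>m (N - 1) - B) *\<^sub>v interior_vec N V) $ (i - 1) =
      ((1\<^sub>m (N - 1) + B) *\<^sub>v interior_vec N U) $ (i - 1)
        + (K1 * \<tau> / (2 * h powr \<alpha>) *
            (w (i + 1) * (U 0 + V 0) + (if i = N - 1 then w 0 * (U N + V N) else 0))
          + K2 * \<tau> / (2 * h powr \<alpha>) *
            (w (N - i + 1) * (U N + V N) + (if i = 1 then w 0 * (U 0 + V 0) else 0))
          + s)"
proof -
  have B: "B \<in> carrier_mat (N - 1) (N - 1)" unfolding B_def by (rule cn_wsgd_mat_carrier)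
  have Bv: "(B *\<^sub>v interior_vec N W) $ (i - 1) =
      \<tau> / (2 * h powr \<alpha>) * (K1 * (wsgd_mat \<alpha> p q N *\<^sub>v interior_vec N W) $ (i - 1)
        + K2 * (transpose_mat (wsgd_mat \<alpha> p q N) *\<^sub>v interior_vec N W) $ (i - 1))" for W
    using i unfolding B_def
    by (subst cn_wsgd_mat_mult_vec)
      (auto simp: interior_vec_carrier simp del: index_mult_mat_vec One_nat_def)
  have W: "interior_vec N W $ (i - 1) = W i" for W
    using i by (cases i) (simp_all add: interior_vec_def)
  have minus: "((1\<^sub>m (N - 1) - B) *\<^sub>v interior_vec N V) $ (i - 1) =
      V i - (B *\<^sub>v interior_vec N V) $ (i - 1)"
    using i B by (subst minus_mult_distrib_mat_vec[of _ "N - 1" "N - 1"])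
      (auto simp: W interior_vec_carrier simp del: index_mult_mat_vec One_nat_def)
  have plus: "((1\<^sub>m (N - 1) + B) *\<^sub>v interior_vec N U) $ (i - 1) =
      U i + (B *\<^sub>v interior_vec N U) $ (i - 1)"
    using i B by (subst add_mult_distrib_mat_vec[of _ "N - 1" "N - 1"])
      (auto simp: W interior_vec_carrier simp del: index_mult_mat_vec One_nat_def)
  show ?thesis
    unfolding minus plus Bv w_def left_sum_conv_mat[OF i] right_sum_conv_mat[OF i]
    by (simp add: algebra_simps add_divide_distrib diff_divide_distrib del: index_mult_mat_vec)
qed

text \<open>The scheme uses grid values at the boundary nodes, \<open>cn_wsgd_rhs\<close> the
  functions \<open>\<phi>a\<close> and \<open>\<phi>b\<close>. Both sides impose the boundary
  conditions at all levels up to \<open>M\<close>, hence at \<open>n\<close> and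
  \<open>n + 1\<close> for \<open>n < M\<close>, where the two agree.\<close>

lemma cn_wsgd_scheme_iff_matrix_form:
  "cn_wsgd_scheme \<alpha> p q K1 K2 a b T u0 \<phi>a \<phi>b f N M U \<longleftrightarrow>
   cn_wsgd_matrix_form \<alpha> p q K1 K2 a b T u0 \<phi>a \<phi>b f N M U"
proof -
  define h \<tau> where "h = (b - a) / real N" and "\<tau> = T / real M"
  define B where "B = cn_wsgd_mat \<alpha> p q K1 K2 N \<tau> h"
  let ?w = "wsgd_weight p q \<alpha>"
  define r where "r = cn_wsgd_rhs \<alpha> p q K1 K2 a b T \<phi>a \<phi>b f N M"
  define step where "step n i \<longleftrightarrow>
      U (n+1) i - K1 * \<tau> / (2 * h powr \<alpha>) * (\<Sum>k=0..i+1. ?w k * U (n+1) (i + 1 - k))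
        - K2 * \<tau> / (2 * h powr \<alpha>) * (\<Sum>k=0..N-i+1. ?w k * U (n+1) (i + k - 1))
      = U n i + K1 * \<tau> / (2 * h powr \<alpha>) * (\<Sum>k=0..i+1. ?w k * U n (i + 1 - k))
        + K2 * \<tau> / (2 * h powr \<alpha>) * (\<Sum>k=0..N-i+1. ?w k * U n (i + k - 1))
        + \<tau> * f (a + real i * h) ((real n * \<tau> + real (n + 1) * \<tau>) / 2)" for n i
  have B: "B \<in> carrier_mat (N - 1) (N - 1)" unfolding B_def by (rule cn_wsgd_mat_carrier)
  have r_dim: "dim_vec (r n) = N - 1" for n
    by (simp add: r_def cn_wsgd_rhs_def interior_vec_def Let_def)
  have main: "(\<forall>i\<in>{1..N-1}. step n i) \<longleftrightarrow>
      (1\<^sub>m (N - 1) - B) *\<^sub>v interior_vec N (U (n+1)) =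
      (1\<^sub>m (N - 1) + B) *\<^sub>v interior_vec N (U n) + r n"
    if n: "n < M" and bc: "\<forall>n\<le>M. U n 0 = \<phi>a (real n * \<tau>) \<and> U n N = \<phi>b (real n * \<tau>)" for n
  proof -
    have "step n i \<longleftrightarrow> ((1\<^sub>m (N - 1) - B) *\<^sub>v interior_vec N (U (n+1))) $ (i - 1) =
        ((1\<^sub>m (N - 1) + B) *\<^sub>v interior_vec N (U n) + r n) $ (i - 1)"
      if i: "1 \<le> i" "i \<le> N - 1" for i
    proof -
      have bcn: "U n 0 = \<phi>a (real n * \<tau>)" "U n N = \<phi>b (real n * \<tau>)"
        "U (n+1) 0 = \<phi>a (real (n+1) * \<tau>)" "U (n+1) N = \<phi>b (real (n+1) * \<tau>)"
        using bc n by (auto simp del: of_nat_add of_nat_Suc)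
      have "r n $ (i - 1) = K1 * \<tau> / (2 * h powr \<alpha>) *
            (?w (i + 1) * (U n 0 + U (n+1) 0)
              + (if i = N - 1 then ?w 0 * (U n N + U (n+1) N) else 0))
          + K2 * \<tau> / (2 * h powr \<alpha>) *
            (?w (N - i + 1) * (U n N + U (n+1) N)
              + (if i = 1 then ?w 0 * (U n 0 + U (n+1) 0) else 0))
          + \<tau> * f (a + real i * h) ((real n * \<tau> + real (n + 1) * \<tau>) / 2)"
        using i unfolding r_def cn_wsgd_rhs_def Let_def bcn h_def[symmetric] \<tau>_def[symmetric]
        by (simp add: interior_vec_def)
      moreover have "((1\<^sub>m (N - 1) + B) *\<^sub>v interior_vec N (U n) + r n) $ (i - 1) =
          ((1\<^sub>m (N - 1) + B) *\<^sub>v interior_vec N (U n)) $ (i - 1) + r n $ (i - 1)"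
        using i r_dim by simp
      ultimately show ?thesis
        unfolding step_def B_def using cn_wsgd_scheme_step_iff[OF i] by simp
    qed
    note step_iff = this
    have "(\<forall>i\<in>{1..N-1}. step n i) \<longleftrightarrow> (\<forall>j<N - 1. step n (Suc j))"
      by (metis atLeastAtMost_iff One_nat_def Suc_le_D Suc_le_eq Suc_le_mono zero_le)
    also have "\<dots> \<longleftrightarrow> (\<forall>j<N - 1. ((1\<^sub>m (N - 1) - B) *\<^sub>v interior_vec N (U (n+1))) $ j =
        ((1\<^sub>m (N - 1) + B) *\<^sub>v interior_vec N (U n) + r n) $ j)"
      using step_iff[of "Suc _"] by (simp del: index_mult_mat_vec index_add_vec)
    also have "\<dots> \<longleftrightarrow> (1\<^sub>m (N - 1) - B) *\<^sub>v interior_vec N (U (n+1)) =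
        (1\<^sub>m (N - 1) + B) *\<^sub>v interior_vec N (U n) + r n"
      using r_dim[of n] by (subst vec_eq_iff) (use B in auto)
    finally show ?thesis .
  qed
  show ?thesis
    unfolding cn_wsgd_scheme_def cn_wsgd_matrix_form_def Let_def
      h_def[symmetric] \<tau>_def[symmetric] B_def[symmetric] r_def[symmetric] step_def[symmetric]
    using main by auto
qed

section \<open>Cayley transforms of negative definite matrices\<close>

text \<open>Since \<open>B\<close> is real, the products mixing real and imaginary parts of
  \<open>v\<close> are purely imaginary. This carries a sign condition from real to complex
  vectors.\<close>

lemma Re_quadratic_form_of_real_mat:
  fixes B :: "real mat" and v :: "complex vec"
  assumes B: "B \<in> carrier_mat n n" and v: "v \<in> carrier_vec n"
  shows "Re ((map_mat complex_of_real B *\<^sub>v v) \<bullet> conjugate v) =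
    map_vec Re v \<bullet> (B *\<^sub>v map_vec Re v) + map_vec Im v \<bullet> (B *\<^sub>v map_vec Im v)"
proof -
  have "(\<Sum>i<n. Re ((\<Sum>j<n. complex_of_real (B $$ (i, j)) * v $ j) * cnj (v $ i))) =
      (\<Sum>i<n. Re (v $ i) * (\<Sum>j<n. B $$ (i, j) * Re (v $ j))) +
      (\<Sum>i<n. Im (v $ i) * (\<Sum>j<n. B $$ (i, j) * Im (v $ j)))"
    unfolding sum.distrib[symmetric] by (rule sum.cong) (simp_all add: mult.commute)
  then show ?thesis using B v by (simp add: scalar_prod_def atLeast0LessThan)
qed

lemma cayley_spectral_radius_less_1:
  fixes B :: "real mat"
  assumes B: "B \<in> carrier_mat n n" and n: "0 < n"
    and neg: "\<And>x. x \<in> carrier_vec n \<Longrightarrow> x \<noteq> 0\<^sub>v n \<Longrightarrow> x \<bullet> (B *\<^sub>v x) < 0"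
  shows "invertible_mat (1\<^sub>m n - B)"
    and "spectral_radius (map_mat complex_of_real (cn_iteration_mat B)) < 1"
proof -
  let ?c = "map_mat complex_of_real"
  let ?D = "1\<^sub>m n - B"
  have D: "?D \<in> carrier_mat n n" by (rule minus_carrier_mat[OF B])
  have "det ?D \<noteq> 0"
  proof
    assume "det ?D = 0"
    then obtain v where v: "v \<in> carrier_vec n" "v \<noteq> 0\<^sub>v n" "?D *\<^sub>v v = 0\<^sub>v n"
      using det_0_iff_vec_prod_zero_field[OF D] by blast
    have "v - B *\<^sub>v v = 0\<^sub>v n"
      using v B by (simp add: minus_mult_distrib_mat_vec[of _ n n])
    then have "v \<bullet> (v - B *\<^sub>v v) = 0" using v by simp
    then have "v \<bullet> v = v \<bullet> (B *\<^sub>v v)"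
      using v B by (subst (asm) scalar_prod_minus_distrib[of _ n]) auto
    moreover have "0 \<le> v \<bullet> v" by (simp add: scalar_prod_def sum_nonneg)
    ultimately show False using neg[OF v(1,2)] by simp
  qed
  \<comment> \<open>\<open>mat_inverse\<close> yields \<open>None\<close> only outside the units of
    the matrix ring, so \<open>the\<close> in \<open>cn_iteration_mat\<close> returns a genuine
    inverse.\<close>
  then have "?D \<in> Units (ring_mat TYPE(real) n ())"
    by (rule det_non_zero_imp_unit[OF D])
  then obtain C where "mat_inverse ?D = Some C"
    using mat_inverse(1)[OF D, where b = "()"] by (cases "mat_inverse ?D") auto
  then have DC: "?D * C = 1\<^sub>m n" "C * ?D = 1\<^sub>m n" "C \<in> carrier_mat n n"
    and it: "cn_iteration_mat B = C * (1\<^sub>m n + B)"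
    using mat_inverse(2)[OF D] B by (auto simp: cn_iteration_mat_def)
  show "invertible_mat ?D"
    using DC D B unfolding invertible_mat_def inverts_mat_def by (auto intro!: exI[of _ C])
  define M where "M = ?c (cn_iteration_mat B)"
  have Mc: "M \<in> carrier_mat n n" using DC B by (simp add: M_def it)
  obtain \<mu> where \<mu>: "\<mu> \<in> spectrum M" "norm \<mu> = spectral_radius M"
    using spectral_radius_mem_max(1)[OF Mc n] by auto
  then obtain v where v: "v \<in> carrier_vec n" "v \<noteq> 0\<^sub>v n" "M *\<^sub>v v = \<mu> \<cdot>\<^sub>v v"
    using Mc unfolding spectrum_def eigenvalue_def eigenvector_def by auto
  \<comment> \<open>Multiplying by \<open>?D\<close> removes the inverse \<open>C\<close>: the
    eigenvalue equation becomes \<open>(I + B) v = \<mu> (I - B) v\<close>.\<close>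
  have DM: "?c ?D * M = 1\<^sub>m n + ?c B"
  proof -
    have "?D * cn_iteration_mat B = (?D * C) * (1\<^sub>m n + B)"
      unfolding it using DC D B by (intro assoc_mult_mat[symmetric]) auto
    also have "\<dots> = 1\<^sub>m n + B" using DC B by simp
    finally have "?c ?D * M = ?c (1\<^sub>m n + B)"
      unfolding M_def using D B DC it
      by (subst of_real_hom.mat_hom_mult[symmetric, of _ n n _ n]) auto
    also have "\<dots> = 1\<^sub>m n + ?c B"
      using B by (intro eq_matI) auto
    finally show ?thesis .
  qed
  have Dc: "?c ?D = 1\<^sub>m n - ?c B" using B by (intro eq_matI) auto
  have Bc: "?c B \<in> carrier_mat n n" using B by simp
  have Bv: "?c B *\<^sub>v v \<in> carrier_vec n" using Bc v(1) by simp
  have "v + ?c B *\<^sub>v v = (?c ?D * M) *\<^sub>v v"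
    unfolding DM using Bc v by (simp add: add_mult_distrib_mat_vec[of _ n n])
  also have "\<dots> = ?c ?D *\<^sub>v (\<mu> \<cdot>\<^sub>v v)"
    using D Mc v by (subst assoc_mult_mat_vec[of _ n n]) auto
  also have "\<dots> = \<mu> \<cdot>\<^sub>v (v - ?c B *\<^sub>v v)"
    unfolding Dc using Bc v
    by (subst mult_mat_vec[of _ n n]) (auto simp: minus_mult_distrib_mat_vec[of _ n n])
  finally have eq: "(v + ?c B *\<^sub>v v) \<bullet> conjugate v = (\<mu> \<cdot>\<^sub>v (v - ?c B *\<^sub>v v)) \<bullet> conjugate v" by simp
  define s \<beta> where "s = Re (v \<bullet> conjugate v)" and "\<beta> = (?c B *\<^sub>v v) \<bullet> conjugate v"
  have vs: "v \<bullet> conjugate v = of_real s"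
    by (simp add: s_def scalar_prod_def complex_eq_iff)
  have s: "0 \<le> s"
    unfolding s_def scalar_prod_def by (auto intro!: sum_nonneg add_nonneg_nonneg)
  have eq': "s + \<beta> = \<mu> * (s - \<beta>)"
  proof -
    have "(\<mu> \<cdot>\<^sub>v (v - ?c B *\<^sub>v v)) \<bullet> conjugate v = \<mu> * ((v - ?c B *\<^sub>v v) \<bullet> conjugate v)"
      using Bv v(1) by (intro smult_scalar_prod_distrib[of _ n]) auto
    then show ?thesis
      using eq Bv v(1) vs
      by (simp add: add_scalar_prod_distrib[of _ n] minus_scalar_prod_distrib[of _ n] \<beta>_def)
  qed
  have \<beta>: "Re \<beta> < 0"
  proof -
    let ?x = "map_vec Re v" and ?y = "map_vec Im v"
    have xy: "?x \<in> carrier_vec n" "?y \<in> carrier_vec n" using v by auto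
    \<comment> \<open>One of the two real vectors contributes a strictly negative term, the other at
      most zero.\<close>
    have "?x \<noteq> 0\<^sub>v n \<or> ?y \<noteq> 0\<^sub>v n"
    proof (rule ccontr)
      assume "\<not> ?thesis"
      then have "?x = 0\<^sub>v n" "?y = 0\<^sub>v n" by auto
      then have "Re (v $ i) = 0" "Im (v $ i) = 0" if "i < n" for i
        using that v(1) by (metis carrier_vecD index_map_vec(1) index_zero_vec(1))+
      then have "v = 0\<^sub>v n" using v(1) by (intro eq_vecI) (auto simp: complex_eq_iff)
      with v(2) show False ..
    qed
    moreover have "x \<bullet> (B *\<^sub>v x) \<le> 0" if "x \<in> carrier_vec n" for x
      using neg[OF that] B that by (cases "x = 0\<^sub>v n") auto
    ultimately show ?thesis
      using Re_quadratic_form_of_real_mat[OF B v(1)] neg[OF xy(1)] neg[OF xy(2)] xy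
      unfolding \<beta>_def by (smt (verit, best))
  qed
  have "s \<noteq> 0"
  proof
    assume "s = 0"
    then have "v \<bullet> conjugate v = 0" using vs by simp
    then show False using v by (simp add: conjugate_square_eq_0_vec[of _ n])
  qed
  with s \<beta> have "s * Re \<beta> < 0" by (simp add: mult_less_0_iff)
  moreover have "(norm (s - \<beta>))\<^sup>2 - (norm (s + \<beta>))\<^sup>2 = - 4 * (s * Re \<beta>)"
    unfolding cmod_power2 by (simp add: power2_eq_square algebra_simps)
  ultimately have "(norm (s + \<beta>))\<^sup>2 < (norm (s - \<beta>))\<^sup>2" by linarith
  then have "norm (s + \<beta>) < norm (s - \<beta>)"
    by (rule power2_less_imp_less) simp
  then have "norm \<mu> * norm (s - \<beta>) < 1 * norm (s - \<beta>)"
    using eq' by (simp add: norm_mult)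
  then have "norm \<mu> < 1" by (rule mult_right_less_imp_less) simp
  then show "spectral_radius (?c (cn_iteration_mat B)) < 1"
    using \<mu>(2) by (simp add: M_def)
qed

section \<open>Negative definiteness of the weight matrix\<close>

text \<open>Summation along diagonals: the entries with \<open>i - j = m\<close> share the weight
  \<open>w (m + 1)\<close> and collect to \<open>R m\<close>, while the superdiagonal carries
  \<open>w 0\<close> and collects to \<open>R 1\<close>.\<close>

lemma toeplitz_form_eq_autocorrelations:
  fixes x w :: "nat \<Rightarrow> real" and n :: nat
  assumes x: "\<And>i. n \<le> i \<Longrightarrow> x i = 0"
  defines "R \<equiv> \<lambda>m. \<Sum>i<n. x i * x (i + m)"
  shows "(\<Sum>i<n. \<Sum>j<n. (if j \<le> i + 1 then w (i + 1 - j) else 0) * x i * x j) =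
    w 0 * R 1 + (\<Sum>m<n. w (m + 1) * R m)"
proof -
  have inner: "(\<Sum>i<n. (if j \<le> i + 1 then w (i + 1 - j) else 0) * x i * x j) =
      (\<Sum>m<n. w (m + 1) * (x j * x (j + m))) + (if 0 < j then w 0 * (x (j - 1) * x j) else 0)"
    if j: "j < n" for j
  proof -
    have "(\<Sum>i<n. (if j \<le> i + 1 then w (i + 1 - j) else 0) * x i * x j) =
        (\<Sum>i<n. (if j \<le> i then w (i + 1 - j) * (x j * x i) else 0)) +
        (\<Sum>i<n. if j = i + 1 then w 0 * (x i * x j) else 0)"
      unfolding sum.distrib[symmetric] by (rule sum.cong) auto
    also have "(\<Sum>i<n. (if j = i + 1 then w 0 * (x i * x j) else 0)) =
        (if 0 < j then w 0 * (x (j - 1) * x j) else 0)"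
    proof (cases j)
      case (Suc k)
      then have "(\<Sum>i<n. (if j = i + 1 then w 0 * (x i * x j) else 0)) =
          (\<Sum>i<n. (if i = k then w 0 * (x i * x j) else 0))"
        by (intro sum.cong) auto
      then show ?thesis using Suc j by simp
    qed simp
    also have "(\<Sum>i<n. (if j \<le> i then w (i + 1 - j) * (x j * x i) else 0)) =
        (\<Sum>i\<in>{j..<n}. w (i + 1 - j) * (x j * x i))"
      by (rule sum.mono_neutral_cong_right) auto
    \<comment> \<open>Zero terms are appended so that the range of \<open>m = i - j\<close> no
      longer depends on \<open>j\<close> and the sums can be swapped.\<close>
    also have "\<dots> = (\<Sum>i\<in>{j..<j + n}. w (i + 1 - j) * (x j * x i))"
      by (rule sum.mono_neutral_left) (auto simp: x)
    also have "\<dots> = (\<Sum>m<n. w (m + 1) * (x j * x (j + m)))"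
      by (rule sum.reindex_bij_witness[of _ "\<lambda>m. j + m" "\<lambda>i. i - j"])
        (auto simp: Suc_diff_le)
    finally show ?thesis .
  qed
  have shift: "(\<Sum>j<n. (if 0 < j then w 0 * (x (j - 1) * x j) else 0)) = w 0 * R 1"
  proof (cases n)
    case (Suc k)
    then show ?thesis
      using x[of "Suc k"]
      by (subst Suc, subst sum.lessThan_Suc_shift) (simp add: R_def sum_distrib_left)
qed (simp add: R_def)
  have "(\<Sum>i<n. \<Sum>j<n. (if j \<le> i + 1 then w (i + 1 - j) else 0) * x i * x j) =
      (\<Sum>j<n. \<Sum>i<n. (if j \<le> i + 1 then w (i + 1 - j) else 0) * x i * x j)"
    by (rule sum.swap)
  also have "\<dots> = (\<Sum>j<n. \<Sum>m<n. w (m + 1) * (x j * x (j + m))) + w 0 * R 1"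
    by (simp add: inner sum.distrib shift del: One_nat_def)
  also have "(\<Sum>j<n. \<Sum>m<n. w (m + 1) * (x j * x (j + m))) = (\<Sum>m<n. w (m + 1) * R m)"
    by (subst sum.swap) (simp add: R_def sum_distrib_left)
  finally show ?thesis by simp
qed

section \<open>Inequalities between autocorrelations\<close>

lemma sum_shift_finite_support:
  fixes f :: "nat \<Rightarrow> 'a :: ab_group_add"
  assumes "\<And>i. n \<le> i \<Longrightarrow> f i = 0"
  shows "(\<Sum>i<n. f (Suc i)) = (\<Sum>i<n. f i) - f 0"
proof -
  have "(\<Sum>i<Suc n. f i) = (\<Sum>i<n. f i)" using assms by simp
  then show ?thesis by (simp add: sum.lessThan_Suc_shift algebra_simps del: sum.lessThan_Suc)
qed

text \<open>Follows from \<open>2 a b \<le> a^2 + b^2\<close>, because each shift by one only drops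
  a square from the sum of squares.\<close>

lemma autocorrelation_le:
  fixes x :: "nat \<Rightarrow> real"
  assumes x: "\<And>i. n \<le> i \<Longrightarrow> x i = 0"
  shows "(\<Sum>i<n. x i * x (i + m)) \<le> (\<Sum>i<n. (x i)\<^sup>2)"
proof -
  have "(\<Sum>i<n. (x (i + m))\<^sup>2) \<le> (\<Sum>i<n. (x i)\<^sup>2)"
  proof (induction m)
    case (Suc m)
    have "(\<Sum>i<n. (x (Suc i + m))\<^sup>2) \<le> (\<Sum>i<n. (x (i + m))\<^sup>2)"
      by (subst sum_shift_finite_support[of n "\<lambda>i. (x (i + m))\<^sup>2"]) (auto simp: x)
    then show ?case using Suc by simp
  qed simp
  moreover have "2 * (\<Sum>i<n. x i * x (i + m)) \<le> (\<Sum>i<n. (x i)\<^sup>2) + (\<Sum>i<n. (x (i + m))\<^sup>2)"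
    unfolding sum_distrib_left sum.distrib[symmetric]
    by (intro sum_mono) (metis mult.assoc sum_squares_bound)
  ultimately show ?thesis by linarith
qed

text \<open>Twice the difference of the two sides is \<open>(x 0)^2\<close> plus the squared first
  differences; it vanishes only for a constant sequence starting at zero. This is the source of
  strictness in the definiteness.\<close>

lemma autocorrelation_1_less:
  fixes x :: "nat \<Rightarrow> real"
  assumes x: "\<And>i. n \<le> i \<Longrightarrow> x i = 0" and nz: "\<exists>i. x i \<noteq> 0"
  shows "(\<Sum>i<n. x i * x (i + 1)) < (\<Sum>i<n. (x i)\<^sup>2)"
proof -
  let ?S = "\<Sum>i<n. (x i)\<^sup>2" and ?R = "\<Sum>i<n. x i * x (i + 1)"
  have "(\<Sum>i<n. (x (Suc i) - x i)\<^sup>2) = (\<Sum>i<n. (x (Suc i))\<^sup>2) + ?S - 2 * ?R"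
    unfolding sum_distrib_left sum.distrib[symmetric] sum_subtractf[symmetric]
    by (rule sum.cong) (auto simp: power2_eq_square algebra_simps)
  also have "(\<Sum>i<n. (x (Suc i))\<^sup>2) = ?S - (x 0)\<^sup>2"
    by (subst sum_shift_finite_support[of n "\<lambda>i. (x i)\<^sup>2"]) (auto simp: x)
  finally have eq: "2 * (?S - ?R) = (\<Sum>i<n. (x (Suc i) - x i)\<^sup>2) + (x 0)\<^sup>2" by simp
  have "\<exists>i<n. x (Suc i) \<noteq> x i" if "x 0 = 0"
  proof (rule ccontr)
    assume "\<not> ?thesis"
    then have "x i = 0" for i
      by (induction i) (use that x in \<open>auto, metis not_less le_SucI\<close>)
    with nz show False by blast
  qed
  then have "0 < (\<Sum>i<n. (x (Suc i) - x i)\<^sup>2) + (x 0)\<^sup>2"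
    by (cases "x 0 = 0") (auto intro!: sum_pos2 add_nonneg_pos sum_nonneg)
  with eq show ?thesis by simp
qed

text \<open>
  On the Fourier side this is \<open>1 - cos (2 \<theta>) \<le> 4 (1 - cos \<theta>)\<close>, that is, \<open>0 \<le> \<bar>1 - exp (\<i> \<theta>)\<bar>\<^sup>4\<close>;
  hence the second differences.
\<close>

lemma autocorrelation_2_ge:
  fixes x :: "nat \<Rightarrow> real"
  assumes x: "\<And>i. n \<le> i \<Longrightarrow> x i = 0"
  shows "(\<Sum>i<n. (x i)\<^sup>2) - (\<Sum>i<n. x i * x (i + 2))
    \<le> 4 * ((\<Sum>i<n. (x i)\<^sup>2) - (\<Sum>i<n. x i * x (i + 1)))"
proof -
  let ?S = "\<Sum>i<n. (x i)\<^sup>2" and ?R1 = "\<Sum>i<n. x i * x (Suc i)"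
    and ?R2 = "\<Sum>i<n. x i * x (Suc (Suc i))"
  have S1: "(\<Sum>i<n. (x (Suc i))\<^sup>2) = ?S - (x 0)\<^sup>2"
    by (subst sum_shift_finite_support[of n "\<lambda>i. (x i)\<^sup>2"]) (auto simp: x)
  have S2: "(\<Sum>i<n. (x (Suc (Suc i)))\<^sup>2) = ?S - (x 0)\<^sup>2 - (x 1)\<^sup>2"
    by (subst sum_shift_finite_support[of n "\<lambda>i. (x (Suc i))\<^sup>2"]) (auto simp: x S1)
  have R1: "(\<Sum>i<n. x (Suc i) * x (Suc (Suc i))) = ?R1 - x 0 * x 1"
    by (subst sum_shift_finite_support[of n "\<lambda>i. x i * x (Suc i)"]) (auto simp: x)
  have "0 \<le> (\<Sum>i<n. (x (Suc (Suc i)) - 2 * x (Suc i) + x i)\<^sup>2)" by (simp add: sum_nonneg)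
  also have "\<dots> = (\<Sum>i<n. (x (Suc (Suc i)))\<^sup>2) + 4 * (\<Sum>i<n. (x (Suc i))\<^sup>2) + ?S
      - 4 * (\<Sum>i<n. x (Suc i) * x (Suc (Suc i))) - 4 * ?R1 + 2 * ?R2"
    unfolding sum_distrib_left sum.distrib[symmetric] sum_subtractf[symmetric]
    by (rule sum.cong) (auto simp: power2_eq_square algebra_simps)
  \<comment> \<open>The two subtracted squares are the second differences across the left end, with
    \<open>x\<close> continued by zero to the indices -1 and -2.\<close>
  also have "\<dots> = 6 * ?S - 8 * ?R1 + 2 * ?R2 - (x 0)\<^sup>2 - (2 * x 0 - x 1)\<^sup>2"
    unfolding S1 S2 R1 by (simp add: power2_eq_square algebra_simps)
  finally have "(x 0)\<^sup>2 + (2 * x 0 - x 1)\<^sup>2 \<le> 6 * ?S - 8 * ?R1 + 2 * ?R2" by simp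
  moreover have "0 \<le> (x 0)\<^sup>2 + (2 * x 0 - x 1)\<^sup>2" by simp
  ultimately have "0 \<le> 6 * ?S - 8 * ?R1 + 2 * ?R2" by (rule order_trans[rotated])
  then have "?S - ?R2 \<le> 4 * (?S - ?R1)" by argo
  then show ?thesis by simp
qed

text \<open>
  For the shift \<open>(1, -1)\<close> the weight \<open>w 3\<close> may be negative, so diagonal dominance is not
  available; the term is absorbed by means of \<open>autocorrelation_2_ge\<close>.
\<close>

lemma toeplitz_form_neg:
  fixes x w :: "nat \<Rightarrow> real"
  assumes x: "\<And>i. n \<le> i \<Longrightarrow> x i = 0" and nz: "\<exists>i. x i \<noteq> 0"
    and w_nonneg: "\<And>k. 4 \<le> k \<Longrightarrow> 0 \<le> w k"
    and w_sum: "\<And>K. 3 \<le> K \<Longrightarrow> (\<Sum>k\<le>K. w k) \<le> 0"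
    and w02: "0 < w 0 + w 2" and w023: "0 < w 0 + w 2 + 4 * w 3"
  shows "(\<Sum>i<n. \<Sum>j<n. (if j \<le> i + 1 then w (i + 1 - j) else 0) * x i * x j) < 0"
proof -
  define R where "R m = (\<Sum>i<n. x i * x (i + m))" for m
  define S where "S = (\<Sum>i<n. (x i)\<^sup>2)"
  have R0: "R 0 = S" by (simp add: R_def S_def power2_eq_square)
  have R_le: "R m \<le> S" for m unfolding R_def S_def by (rule autocorrelation_le[OF x])
  have R1: "R 1 < S" unfolding R_def S_def by (rule autocorrelation_1_less[OF x nz])
  have R2: "S - R 2 \<le> 4 * (S - R 1)" unfolding R_def S_def by (rule autocorrelation_2_ge[OF x])
  have S: "0 \<le> S" by (simp add: S_def sum_nonneg)
  have Rz: "R m = 0" if "n \<le> m" for m using that by (simp add: R_def x)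
  \<comment> \<open>Padding by three zero terms allows splitting off \<open>w 1\<close>,
    \<open>w 2\<close>, \<open>w 3\<close> even for small \<open>n\<close>.\<close>
  have "(\<Sum>m<n. w (m + 1) * R m) = (\<Sum>m<n + 3. w (m + 1) * R m)"
    by (rule sum.mono_neutral_left) (auto simp: Rz)
  also have "\<dots> = w 1 * S + w 2 * R 1 + w 3 * R 2 + (\<Sum>m<n. w (m + 4) * R (m + 3))"
    by (simp add: eval_nat_numeral sum.lessThan_Suc_shift R0 add.assoc
        del: sum.lessThan_Suc)
  also have "(\<Sum>m<n. w (m + 4) * R (m + 3)) \<le> (\<Sum>m<n. w (m + 4) * S)"
    by (intro sum_mono mult_left_mono R_le w_nonneg) simp
  finally have "(\<Sum>m<n. w (m + 1) * R m) \<le> w 1 * S + w 2 * R 1 + w 3 * R 2 + (\<Sum>m<n. w (m + 4)) * S"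
    by (simp add: sum_distrib_right)
  moreover have "(\<Sum>k\<le>n + 3. w k) = w 0 + w 1 + w 2 + w 3 + (\<Sum>m<n. w (m + 4))"
    by (simp add: eval_nat_numeral sum.lessThan_Suc_shift lessThan_Suc_atMost[symmetric]
        add.assoc del: sum.lessThan_Suc)
  ultimately have "w 0 * R 1 + (\<Sum>m<n. w (m + 1) * R m) \<le>
      (\<Sum>k\<le>n + 3. w k) * S - ((w 0 + w 2) * (S - R 1) + w 3 * (S - R 2))"
    by (simp add: algebra_simps)
  moreover have "(\<Sum>k\<le>n + 3. w k) * S \<le> 0"
    using w_sum[of "n + 3"] S by (simp add: mult_nonpos_nonneg)
  moreover have "0 < (w 0 + w 2) * (S - R 1) + w 3 * (S - R 2)"
  proof (cases "0 \<le> w 3")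
    case True
    then show ?thesis using w02 R1 R_le[of 2] by (simp add: add_pos_nonneg)
  next
    case False
    \<comment> \<open>Multiplied by the negative \<open>w 3\<close>, the bound \<open>R2\<close>
      gives a lower bound; its constant 4 is the one in \<open>w023\<close>.\<close>
    have "0 < (w 0 + w 2 + 4 * w 3) * (S - R 1)" using w023 R1 by simp
    also have "\<dots> = (w 0 + w 2) * (S - R 1) + w 3 * (4 * (S - R 1))" by (simp add: algebra_simps)
    also have "\<dots> \<le> (w 0 + w 2) * (S - R 1) + w 3 * (S - R 2)"
      using R2 False by (intro add_left_mono mult_left_mono_neg) auto
    finally show ?thesis .
  qed
  moreover have "(\<Sum>i<n. \<Sum>j<n. (if j \<le> i + 1 then w (i + 1 - j) else 0) * x i * x j) =
      w 0 * R 1 + (\<Sum>m<n. w (m + 1) * R m)"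
    unfolding R_def by (rule toeplitz_form_eq_autocorrelations) (rule x)
  ultimately show ?thesis by linarith
qed

section \<open>Signs of the Grunwald coefficients and of their partial sums\<close>

text \<open>
  The \<open>grunwald_coeff \<alpha> k\<close> are the coefficients of \<open>(1 - z)\<^sup>\<alpha>\<close>, so their partial sums are those of
  \<open>(1 - z)\<^sup>\<alpha> / (1 - z)\<close>.
\<close>

lemma grunwald_coeff_absorption:
  "grunwald_coeff \<alpha> (Suc k) = - \<alpha> / real (Suc k) * grunwald_coeff (\<alpha> - 1) k"
proof (induction k)
  case (Suc k)
  have "grunwald_coeff \<alpha> (Suc (Suc k)) =
      (1 - (\<alpha> + 1) / real (Suc (Suc k))) * (- \<alpha> / real (Suc k) * grunwald_coeff (\<alpha> - 1) k)"
    by (subst grunwald_coeff.simps(2)) (simp only: Suc.IH)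
  also have "\<dots> = - \<alpha> / real (Suc (Suc k)) * ((1 - \<alpha> / real (Suc k)) * grunwald_coeff (\<alpha> - 1) k)"
    by (simp add: field_simps)
  finally show ?case by simp
qed simp

text \<open>By absorption, adding the next coefficient multiplies the partial sum by
  \<open>1 - \<alpha> / (n + 1)\<close>, the recursion factor for the order
  \<open>\<alpha> - 1\<close>.\<close>

lemma sum_grunwald_coeff: "(\<Sum>k\<le>n. grunwald_coeff \<alpha> k) = grunwald_coeff (\<alpha> - 1) n"
proof (induction n)
  case (Suc n)
  then show ?case
    by (simp only: sum.atMost_Suc grunwald_coeff_absorption[of \<alpha>]) (simp add: algebra_simps)
qed simp

text \<open>The first factor is \<open>- \<alpha>\<close>; all later ones are nonnegative because
  \<open>\<alpha> + 1 \<le> 2\<close>.\<close>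

lemma grunwald_coeff_nonpos:
  assumes "0 \<le> \<alpha>" "\<alpha> \<le> 1"
  shows "grunwald_coeff \<alpha> (Suc k) \<le> 0"
proof (induction k)
  case (Suc k)
  have "0 \<le> 1 - (\<alpha> + 1) / real (Suc (Suc k))" using assms by (simp add: field_simps)
  with Suc show ?case by (subst grunwald_coeff.simps(2)) (rule mult_nonneg_nonpos)
qed (use assms in simp)

text \<open>Absorption lowers the order to \<open>\<alpha> - 1\<close>, which lies between 0 and 1,
  at the price of a nonpositive factor.\<close>

lemma grunwald_coeff_nonneg:
  assumes "1 \<le> \<alpha>" "\<alpha> \<le> 2"
  shows "0 \<le> grunwald_coeff \<alpha> (Suc (Suc k))"
  unfolding grunwald_coeff_absorption[of \<alpha>]
  using assms grunwald_coeff_nonpos[of "\<alpha> - 1" k]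
  by (intro mult_nonpos_nonpos) (auto simp del: grunwald_coeff.simps)

lemma sum_grunwald_coeff_nonpos:
  assumes "1 \<le> \<alpha>" "\<alpha> \<le> 2"
  shows "(\<Sum>k\<le>Suc n. grunwald_coeff \<alpha> k) \<le> 0"
  unfolding sum_grunwald_coeff using assms by (intro grunwald_coeff_nonpos) auto

section \<open>Signs of the weights\<close>

text \<open>The weights are convex combinations of the Grunwald coefficients and the same sequence
  delayed by one or two steps, so beyond the first indices the signs are inherited. The last two
  claims concern explicit polynomials in \<open>\<alpha>\<close>.\<close>

lemma wsgd_weights:
  fixes \<alpha> :: real and p q :: int
  assumes \<alpha>: "1 < \<alpha>" "\<alpha> \<le> 2" and pq: "(p, q) \<in> {(1, 0), (1, -1)}"
  defines "w \<equiv> wsgd_weight p q \<alpha>"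
  shows wsgd_weight_nonneg: "4 \<le> k \<Longrightarrow> 0 \<le> w k"
    and sum_wsgd_weight_nonpos: "3 \<le> n \<Longrightarrow> (\<Sum>k\<le>n. w k) \<le> 0"
    and wsgd_weight_0_2: "0 < w 0 + w 2"
    and wsgd_weight_0_2_3: "0 < w 0 + w 2 + 4 * w 3"
proof -
  let ?g = "grunwald_coeff \<alpha>"
  let ?G = "\<lambda>n. \<Sum>k\<le>n. grunwald_coeff \<alpha> k"
  have g: "0 \<le> ?g k" if "2 \<le> k" for k
    using grunwald_coeff_nonneg[of \<alpha> "k - 2"] \<alpha> that
    by (simp add: numeral_2_eq_2 Suc_diff_Suc del: grunwald_coeff.simps)
  have G: "?G n \<le> 0" if "1 \<le> n" for n
    using sum_grunwald_coeff_nonpos[of \<alpha> "n - 1"] \<alpha> that by simp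
  have g_vals: "?g 0 = 1" "?g (Suc 0) = - \<alpha>" "?g 2 = \<alpha> * (\<alpha> - 1) / 2"
    "?g 3 = \<alpha> * (\<alpha> - 1) * (2 - \<alpha>) / 6"
    by (simp_all add: eval_nat_numeral field_simps)
  consider (a) "p = 1" "q = 0" | (b) "p = 1" "q = -1" using pq by auto
  then have "(4 \<le> k \<longrightarrow> 0 \<le> w k) \<and> (3 \<le> n \<longrightarrow> (\<Sum>k\<le>n. w k) \<le> 0) \<and> 0 < w 0 + w 2
    \<and> 0 < w 0 + w 2 + 4 * w 3"
  proof cases
    case a
    have w: "w k = (if k = 0 then \<alpha> / 2 * ?g 0 else \<alpha> / 2 * ?g k + (2 - \<alpha>) / 2 * ?g (k - 1))" for k
      by (simp add: w_def a wsgd_weight_def)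
    \<comment> \<open>With a delay of one, \<open>w 3\<close> is already nonnegative, so the last
      claim will follow from the third.\<close>
    have wn: "0 \<le> w k" if "3 \<le> k" for k
      using that \<alpha> g[of k] g[of "k - 1"] by (simp add: w)
    have "(\<Sum>k\<le>Suc n. w k) = \<alpha> / 2 * ?G (Suc n) + (2 - \<alpha>) / 2 * ?G n" for n
      by (induction n) (simp_all add: w algebra_simps del: grunwald_coeff.simps)
    then have ws: "(\<Sum>k\<le>Suc n. w k) \<le> 0" if "1 \<le> n" for n
      using that \<alpha> G[of n] G[of "Suc n"]
      by (simp add: mult_nonneg_nonpos add_nonpos_nonpos del: sum.atMost_Suc)
    have "w 0 + w 2 = \<alpha> * ((\<alpha> - 1) * (\<alpha> + 2)) / 4"
      by (simp add: w g_vals field_simps del: grunwald_coeff.simps)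
    moreover have "0 < \<alpha> * ((\<alpha> - 1) * (\<alpha> + 2))" using \<alpha> by simp
    ultimately have w02: "0 < w 0 + w 2" by linarith
    have "(\<Sum>k\<le>n. w k) \<le> 0" if "3 \<le> n"
      using ws[of "n - 1"] that by simp
    moreover have "0 < w 0 + w 2 + 4 * w 3"
      using w02 wn[OF order_refl] by linarith
    ultimately show ?thesis using wn w02 by simp
  next
    case b
    define c d where "c = (2 + \<alpha>) / 4" and "d = (2 - \<alpha>) / 4"
    have cd: "0 \<le> c" "0 \<le> d" using \<alpha> by (simp_all add: c_def d_def)
    have w0: "w 0 = c * ?g 0" and w1: "w (Suc 0) = c * ?g (Suc 0)"
      and w2: "w (Suc (Suc k)) = c * ?g (Suc (Suc k)) + d * ?g k" for k
      by (simp_all add: w_def b wsgd_weight_def c_def d_def)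
    have w2': "w 2 = c * ?g 2 + d * ?g 0" and w3: "w 3 = c * ?g 3 + d * ?g (Suc 0)"
      using w2[of 0] w2[of "Suc 0"] by (simp_all add: eval_nat_numeral del: grunwald_coeff.simps)
    have wn: "0 \<le> w k" if "4 \<le> k" for k
    proof -
      have "k = Suc (Suc (k - 2))" using that by simp
      then show ?thesis using w2[of "k - 2"] cd g[of k] g[of "k - 2"] that by simp
    qed
    \<comment> \<open>As \<open>?G 0 = 1\<close>, the delayed sum has the right sign only from
      \<open>n = 1\<close> on; hence the bound \<open>3 \<le> n\<close> in the claim.\<close>
    have "(\<Sum>k\<le>Suc (Suc n). w k) = c * ?G (Suc (Suc n)) + d * ?G n" for n
      by (induction n) (simp_all add: w0 w1 w2 algebra_simps del: grunwald_coeff.simps)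
    then have ws: "(\<Sum>k\<le>Suc (Suc n). w k) \<le> 0" if "1 \<le> n" for n
      using that cd G[of n] G[of "Suc (Suc n)"]
      by (simp add: mult_nonneg_nonpos add_nonpos_nonpos del: sum.atMost_Suc)
    have "w 0 + w 2 = ((2 + \<alpha>) * (2 + \<alpha> * (\<alpha> - 1)) + 2 * (2 - \<alpha>)) / 8"
      by (simp add: w0 w2' g_vals c_def d_def field_simps del: grunwald_coeff.simps)
    moreover have "0 < (2 + \<alpha>) * (2 + \<alpha> * (\<alpha> - 1)) + 2 * (2 - \<alpha>)"
      using \<alpha> by (intro add_pos_nonneg mult_pos_pos) auto
    ultimately have w02: "0 < w 0 + w 2" by simp
    \<comment> \<open>The terms without \<open>?g 2\<close> and \<open>?g 3\<close> add up to
      \<open>1 - \<alpha> (2 - \<alpha>) = (\<alpha> - 1)^2\<close>, so \<open>\<alpha> - 1\<close>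
      is a common factor.\<close>
    have "w 0 + w 2 + 4 * w 3 = (\<alpha> - 1) * (4 * \<alpha> * (4 - \<alpha>\<^sup>2) + 3 * \<alpha>\<^sup>2 + 30 * \<alpha> - 24) / 24"
      by (simp add: w0 w2' w3 g_vals c_def d_def field_simps power2_eq_square del: grunwald_coeff.simps)
    moreover have "\<alpha>\<^sup>2 \<le> 2\<^sup>2" using \<alpha> by (intro power_mono) auto
    then have "0 \<le> 4 * \<alpha> * (4 - \<alpha>\<^sup>2)" using \<alpha> by simp
    then have "0 < 4 * \<alpha> * (4 - \<alpha>\<^sup>2) + 3 * \<alpha>\<^sup>2 + 30 * \<alpha> - 24"
      using \<alpha> by (smt (verit) zero_le_power2)
    then have "0 < (\<alpha> - 1) * (4 * \<alpha> * (4 - \<alpha>\<^sup>2) + 3 * \<alpha>\<^sup>2 + 30 * \<alpha> - 24)"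
      using \<alpha> by simp
    ultimately have w023: "0 < w 0 + w 2 + 4 * w 3" by linarith
    have "(\<Sum>k\<le>n. w k) \<le> 0" if "3 \<le> n"
    proof -
      have "n = Suc (Suc (n - 2))" using that by simp
      then show ?thesis using ws[of "n - 2"] that by simp
    qed
    then show ?thesis using wn w02 w023 by simp
  qed
  then show "4 \<le> k \<Longrightarrow> 0 \<le> w k" "3 \<le> n \<Longrightarrow> (\<Sum>k\<le>n. w k) \<le> 0"
    "0 < w 0 + w 2" "0 < w 0 + w 2 + 4 * w 3" by auto
qed

section \<open>Definiteness of the matrices and stability\<close>

lemma wsgd_mat_negative_definite:
  assumes "1 < \<alpha>" "\<alpha> \<le> 2" "(p, q) \<in> {(1, 0), (1, -1)}"
    and x: "x \<in> carrier_vec (N - 1)" "x \<noteq> 0\<^sub>v (N - 1)"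
  shows "x \<bullet> (wsgd_mat \<alpha> p q N *\<^sub>v x) < 0"
proof -
  define y where "y i = (if i < N - 1 then x $ i else 0)" for i
  have "\<exists>i. y i \<noteq> 0"
  proof (rule ccontr)
    assume "\<nexists>i. y i \<noteq> 0"
    then have "x $ i = 0" if "i < N - 1" for i using that by (metis y_def)
    then have "x = 0\<^sub>v (N - 1)" using x(1) by (intro eq_vecI) auto
    with x(2) show False ..
  qed
  then have "(\<Sum>i<N - 1. \<Sum>j<N - 1.
      (if j \<le> i + 1 then wsgd_weight p q \<alpha> (i + 1 - j) else 0) * y i * y j) < 0"
    by (intro toeplitz_form_neg wsgd_weights assms) (auto simp: y_def)
  also have "(\<Sum>i<N - 1. \<Sum>j<N - 1.
      (if j \<le> i + 1 then wsgd_weight p q \<alpha> (i + 1 - j) else 0) * y i * y j) =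
      x \<bullet> (wsgd_mat \<alpha> p q N *\<^sub>v x)"
    using x(1)
    by (auto simp: scalar_prod_def wsgd_mat_def y_def atLeast0LessThan sum_distrib_left
        intro!: sum.cong)
  finally show ?thesis .
qed

text \<open>Transposition preserves the quadratic form, so the form of \<open>B\<close> is that of
  \<open>A\<close> times a multiple of \<open>K1 + K2\<close>, which is positive.\<close>

lemma cn_wsgd_mat_negative_definite:
  assumes "1 < \<alpha>" "\<alpha> \<le> 2" "(p, q) \<in> {(1, 0), (1, -1)}"
    and K: "0 \<le> K1" "0 \<le> K2" "K1\<^sup>2 + K2\<^sup>2 \<noteq> 0" and \<tau>: "0 < \<tau>" and h: "0 < h"
    and x: "x \<in> carrier_vec (N - 1)" "x \<noteq> 0\<^sub>v (N - 1)"
  shows "x \<bullet> (cn_wsgd_mat \<alpha> p q K1 K2 N \<tau> h *\<^sub>v x) < 0"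
proof -
  let ?A = "wsgd_mat \<alpha> p q N"
  have A: "?A *\<^sub>v x \<in> carrier_vec (N - 1)" "transpose_mat ?A *\<^sub>v x \<in> carrier_vec (N - 1)"
    by (rule mult_mat_vec_carrier[OF _ x(1)], rule carrier_matI, simp_all)+
  have "x \<bullet> (transpose_mat ?A *\<^sub>v x) = x \<bullet> (?A *\<^sub>v x)"
    using transpose_vec_mult_scalar[OF wsgd_mat_carrier x(1) x(1)] comm_scalar_prod[OF x(1) A(2)]
    by metis
  then have "x \<bullet> (cn_wsgd_mat \<alpha> p q K1 K2 N \<tau> h *\<^sub>v x) =
      \<tau> / (2 * h powr \<alpha>) * ((K1 + K2) * (x \<bullet> (?A *\<^sub>v x)))"
    unfolding cn_wsgd_mat_mult_vec[OF x(1)] using x(1) A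
    by (simp add: scalar_prod_add_distrib[of _ "N - 1"] algebra_simps)
  moreover have "0 < K1 + K2" using K by (cases "K1 = 0") auto
  moreover have "x \<bullet> (?A *\<^sub>v x) < 0" by (rule wsgd_mat_negative_definite[OF assms(1-3) x])
  moreover have "0 < \<tau> / (2 * h powr \<alpha>)" using \<tau> h by simp
  ultimately show ?thesis by (metis mult_pos_neg)
qed

text \<open>The equivalence ties \<open>cn_wsgd_mat\<close> to the scheme itself, so that the
  spectral statement is one about the scheme.\<close>

theorem theorem4:
  fixes \<alpha> K1 K2 a b T :: real and p q :: int
    and u0 \<phi>a \<phi>b :: "real \<Rightarrow> real" and f :: "real \<Rightarrow> real \<Rightarrow> real"
  assumes "1 < \<alpha>" and "\<alpha> \<le> 2"
    and "0 \<le> K1" and "0 \<le> K2" and "K1\<^sup>2 + K2\<^sup>2 \<noteq> 0"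
    and "(p, q) \<in> {(1, 0), (1, -1)}"
    and "a < b" and "0 < T"
    and "K1 \<noteq> 0 \<Longrightarrow> \<forall>t\<in>{0..T}. \<phi>a t = 0"
    and "K2 \<noteq> 0 \<Longrightarrow> \<forall>t\<in>{0..T}. \<phi>b t = 0"
  shows "(\<forall>N M U. 1 \<le> N \<longrightarrow> 1 \<le> M \<longrightarrow>
            (cn_wsgd_scheme \<alpha> p q K1 K2 a b T u0 \<phi>a \<phi>b f N M U \<longleftrightarrow>
             cn_wsgd_matrix_form \<alpha> p q K1 K2 a b T u0 \<phi>a \<phi>b f N M U))
       \<and> unconditionally_stable (cn_wsgd_mat \<alpha> p q K1 K2)"
proof (intro conjI allI impI)
  show "unconditionally_stable (cn_wsgd_mat \<alpha> p q K1 K2)"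
    unfolding unconditionally_stable_def
  proof (intro allI impI)
    fix N :: nat and \<tau> h :: real
    assume "2 \<le> N" and pos: "0 < \<tau>" "0 < h"
    \<comment> \<open>Positive dimension makes the spectrum nonempty, so that an eigenvalue attains
      the spectral radius.\<close>
    then have "0 < N - 1" by simp
    from cayley_spectral_radius_less_1[OF cn_wsgd_mat_carrier this
        cn_wsgd_mat_negative_definite[OF assms(1,2,6,3-5) pos]]
    show "invertible_mat (1\<^sub>m (N - 1) - cn_wsgd_mat \<alpha> p q K1 K2 N \<tau> h) \<and>
      spectral_radius (map_mat complex_of_real
        (cn_iteration_mat (cn_wsgd_mat \<alpha> p q K1 K2 N \<tau> h))) < 1" by blast
  qed
qed (rule cn_wsgd_scheme_iff_matrix_form)

end
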